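(* For every connected graph $H$ (with at least three nodes, of constant size) that is not a clique and every $r \geq 1$, the $r$-round bandwidth complexity of $\textsc{MemList}(H)$ under edge deletions is $\Omega((\log n)/r)$, and the $r$-round bandwidth complexity of $\textsc{MemList}(H)$ under node deletions is $\Omega((\log n)/r)$.
   Context: Dynamic network model: a sequence of graphs $G^0, G^1, \ldots$ with $n$ nodes initially, each obtained from the previous by at most one topological change of the allowed type (edge deletion, resp. node deletion); nodes have distinct IDs from $[n]$, know their neighbors' IDs and initially the whole of $G^0$; communication is synchronous, each round the change happens first, then each node sends a $B$-bit message to each neighbor; nodes detect changes only via their neighbor lists; algorithms are deterministic. An $r$-round algorithm works under the promise that each change at round $i$ is followed by $r-1$ change-free rounds and must output correctly for $G^i$ by the end of round $i+r-1$. The $r$-round bandwidth complexity is the minimum such $B$. $\textsc{MemList}(H)$: each node $v$ lists all subgraphs isomorphic to $H$ containing $v$. *)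

theory Defs
  imports Complex_Main "HOL-Library.Extended_Real"
begin

section \<open>Finite simple graphs\<close>

record 'a ugraph =
  verts :: "'a set"
  edges :: "'a set set"

definition simple_graph :: "'a ugraph \<Rightarrow> bool" where
  "simple_graph G \<longleftrightarrow> finite (verts G) \<and> (\<forall>e\<in>edges G. e \<subseteq> verts G \<and> card e = 2)"

definition neighbors :: "'a ugraph \<Rightarrow> 'a \<Rightarrow> 'a set" where
  "neighbors G v = {u. {u, v} \<in> edges G}"

definition connected_graph :: "'a ugraph \<Rightarrow> bool" where
  "connected_graph G \<longleftrightarrow>
     verts G \<noteq> {} \<and> (\<forall>u\<in>verts G. \<forall>v\<in>verts G. (u, v) \<in> {(x, y). {x, y} \<in> edges G}\<^sup>*)"

definition clique_graph :: "'a ugraph \<Rightarrow> bool" where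
  "clique_graph G \<longleftrightarrow> (\<forall>u\<in>verts G. \<forall>v\<in>verts G. u \<noteq> v \<longrightarrow> {u, v} \<in> edges G)"

text \<open>Subgraphs are not required to be induced.\<close>

definition subgraph_of :: "'a ugraph \<Rightarrow> 'a ugraph \<Rightarrow> bool" where
  "subgraph_of K G \<longleftrightarrow> simple_graph K \<and> verts K \<subseteq> verts G \<and> edges K \<subseteq> edges G"

definition graph_iso :: "'a ugraph \<Rightarrow> 'b ugraph \<Rightarrow> bool" where
  "graph_iso G H \<longleftrightarrow>
     (\<exists>f. bij_betw f (verts G) (verts H) \<and>
          (\<forall>u\<in>verts G. \<forall>v\<in>verts G. {u, v} \<in> edges G \<longleftrightarrow> {f u, f v} \<in> edges H))"

section \<open>Dynamic networks\<close>

text \<open>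
  Nodes are identified with their IDs. \<open>G i\<close> is the graph after the topological change of
  round \<open>i \<ge> 1\<close> (if any), and \<open>G 0\<close> is the initial graph. A change of either type
  below always alters the graph, so a change occurs at round \<open>i\<close> iff \<open>G i \<noteq> G (i - 1)\<close>.
\<close>

type_synonym change_type = "nat ugraph \<Rightarrow> nat ugraph \<Rightarrow> bool"

definition edge_deletion :: change_type where
  "edge_deletion G G' \<longleftrightarrow>
     (\<exists>e\<in>edges G. G' = \<lparr>verts = verts G, edges = edges G - {e}\<rparr>)"

definition node_deletion :: change_type where
  "node_deletion G G' \<longleftrightarrow>
     (\<exists>v\<in>verts G. G' = \<lparr>verts = verts G - {v}, edges = {e \<in> edges G. v \<notin> e}\<rparr>)"

definition dynamic_network :: "change_type \<Rightarrow> nat \<Rightarrow> (nat \<Rightarrow> nat ugraph) \<Rightarrow> bool" where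
  "dynamic_network chg n G \<longleftrightarrow>
     simple_graph (G 0) \<and> verts (G 0) = {1..n} \<and>
     (\<forall>i. G (Suc i) = G i \<or> chg (G i) (G (Suc i)))"

definition change_at :: "(nat \<Rightarrow> nat ugraph) \<Rightarrow> nat \<Rightarrow> bool" where
  "change_at G i \<longleftrightarrow> i \<ge> 1 \<and> G i \<noteq> G (i - 1)"

definition spaced :: "nat \<Rightarrow> (nat \<Rightarrow> nat ugraph) \<Rightarrow> bool" where
  "spaced r G \<longleftrightarrow> (\<forall>i. change_at G i \<longrightarrow> (\<forall>j. i < j \<and> j \<le> i + r - 1 \<longrightarrow> \<not> change_at G j))"

section \<open>Deterministic distributed algorithms\<close>

type_synonym message = "bool list"

text \<open>
  What a node sees in one round: its neighbors after the change, and the message received from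
  each of them (\<open>None\<close> for non-neighbors).
\<close>

type_synonym observation = "nat set \<times> (nat \<Rightarrow> message option)"

text \<open>
  Local computation is unrestricted, so the state of a node is taken to be everything it knows:
  the initial graph, its own ID and its observations in all past rounds (oldest first).
  \<open>send A G0 v obs N u\<close> is the message that node \<open>v\<close>, with past observations
  \<open>obs\<close> and current neighbors \<open>N\<close>, sends to its neighbor \<open>u\<close>.
\<close>

record 'o algorithm =
  send :: "nat ugraph \<Rightarrow> nat \<Rightarrow> observation list \<Rightarrow> nat set \<Rightarrow> nat \<Rightarrow> message"
  answer :: "nat ugraph \<Rightarrow> nat \<Rightarrow> observation list \<Rightarrow> 'o"

definition uses_bandwidth :: "'o algorithm \<Rightarrow> nat \<Rightarrow> bool" where
  "uses_bandwidth A B \<longleftrightarrow> (\<forall>G0 v obs N u. length (send A G0 v obs N u) = B)"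

primrec history :: "'o algorithm \<Rightarrow> (nat \<Rightarrow> nat ugraph) \<Rightarrow> nat \<Rightarrow> nat \<Rightarrow> observation list" where
  "history A G 0 = (\<lambda>v. [])"
| "history A G (Suc i) = (\<lambda>v. history A G i v @
     [(neighbors (G (Suc i)) v,
       \<lambda>u. if u \<in> neighbors (G (Suc i)) v
           then Some (send A (G 0) u (history A G i u) (neighbors (G (Suc i)) u) v)
           else None)])"

definition output_at :: "'o algorithm \<Rightarrow> (nat \<Rightarrow> nat ugraph) \<Rightarrow> nat \<Rightarrow> nat \<Rightarrow> 'o" where
  "output_at A G i v = answer A (G 0) v (history A G i v)"

section \<open>Bandwidth complexity\<close>

text \<open>A problem prescribes the output of each node of each graph.\<close>

type_synonym 'o problem = "nat ugraph \<Rightarrow> nat \<Rightarrow> 'o"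

definition solves :: "'o algorithm \<Rightarrow> change_type \<Rightarrow> 'o problem \<Rightarrow> nat \<Rightarrow> nat \<Rightarrow> bool" where
  "solves A chg P r n \<longleftrightarrow>
     (\<forall>G. dynamic_network chg n G \<and> spaced r G \<longrightarrow>
        (\<forall>i. change_at G i \<longrightarrow> (\<forall>v\<in>verts (G i). output_at A G (i + r - 1) v = P (G i) v)))"

text \<open>
  The value is \<open>\<infinity>\<close> if no bandwidth suffices; this happens, for instance, when
  \<open>r\<close> is too small for news of a change to reach all nodes concerned.
\<close>

definition bandwidth_complexity :: "change_type \<Rightarrow> 'o problem \<Rightarrow> nat \<Rightarrow> nat \<Rightarrow> enat" where
  "bandwidth_complexity chg P r n =
     Inf {enat B | B. \<exists>A :: 'o algorithm. uses_bandwidth A B \<and> solves A chg P r n}"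

definition MemList :: "'a ugraph \<Rightarrow> nat ugraph set problem" where
  "MemList H = (\<lambda>G v. {K. subgraph_of K G \<and> graph_iso K H \<and> v \<in> verts K})"

end

theory Submission
  imports Defs "HOL-Library.FuncSet"
begin

text \<open>
  Let \<open>x\<close> and \<open>z\<close> be distinct non-adjacent vertices of \<open>H\<close>, and let \<open>y\<close> be a neighbor of \<open>z\<close>. The
  initial graph is \<open>H\<close> with \<open>z\<close> replaced by many twins \<open>j\<close>. In the first round, either the edge
  \<open>yj\<close> or the node \<open>j\<close> is deleted for one twin \<open>j\<close>. The list that \<open>x\<close> must output then determines
  \<open>j\<close>, but the neighborhood of \<open>x\<close> is the same for all \<open>j\<close>, so \<open>x\<close> has to learn \<open>j\<close> from the
  messages of its at most \<open>card (verts H)\<close> neighbors in \<open>r\<close> rounds.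
\<close>

section \<open>Counting histories\<close>

text \<open>This contains everything a node with neighborhood \<open>N\<close> can see in one round.
  It is an image of an extensional function space, whose cardinality is known to be
  \<open>(2 ^ B) ^ card N\<close>.\<close>

definition observations :: "nat set \<Rightarrow> nat \<Rightarrow> observation set" where
  "observations N B =
     (\<lambda>g. (N, \<lambda>u. if u \<in> N then Some (g u) else None)) ` (N \<rightarrow>\<^sub>E {l. length l = B})"

lemma card_messages: "card {l :: message. length l = B} = 2 ^ B"
  using card_lists_length_eq[of "UNIV :: bool set" B] by simp

lemma finite_messages: "finite {l :: message. length l = B}"
  using card_messages[of B] by (metis card.infinite power_not_zero zero_neq_numeral)

lemma finite_observations: "finite N \<Longrightarrow> finite (observations N B)"
  unfolding observations_def by (intro finite_imageI finite_PiE finite_messages)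

lemma card_observations_le:
  assumes "finite N"
  shows "card (observations N B) \<le> 2 ^ (B * card N)"
proof -
  have "card (observations N B) \<le> card (N \<rightarrow>\<^sub>E {l :: message. length l = B})"
    unfolding observations_def using assms
    by (intro card_image_le finite_PiE finite_messages)
  also have "\<dots> = 2 ^ (B * card N)"
    using assms by (simp add: card_PiE card_messages power_mult)
  finally show ?thesis .
qed

lemma history_observations:
  assumes "uses_bandwidth A B" and "\<And>i. neighbors (G (Suc i)) v = N"
  shows "set (history A G i v) \<subseteq> observations N B \<and> length (history A G i v) = i"
proof (induction i)
  case (Suc i)
  \<comment> \<open>Restricting makes the messages an extensional function. The observation does not
    change, since it is \<open>None\<close> outside \<open>N\<close>.\<close>
  let ?g = "restrict (\<lambda>u. send A (G 0) u (history A G i u) (neighbors (G (Suc i)) u) v) N"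
  have "?g \<in> N \<rightarrow>\<^sub>E {l. length l = B}"
    using assms(1) by (auto simp: uses_bandwidth_def)
  then have "(\<lambda>g. (N, \<lambda>u. if u \<in> N then Some (g u) else None)) ?g \<in> observations N B"
    unfolding observations_def by (rule imageI)
  moreover have "(N, \<lambda>u. if u \<in> N then Some (?g u) else None) =
     (N, \<lambda>u. if u \<in> N then Some (send A (G 0) u (history A G i u) (neighbors (G (Suc i)) u) v) else None)"
    by (auto simp: fun_eq_iff)
  ultimately show ?case using Suc assms(2)[of i] by simp
qed simp

text \<open>Pigeonhole: the output of \<open>v\<close> is a function of its history, a word of
  length \<open>r\<close> over \<open>observations N B\<close>. If the required outputs differ for
  all \<open>j\<close>, so do these words.\<close>

lemma card_changes_le:
  fixes A :: "'o algorithm"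
  assumes A: "uses_bandwidth A B" "solves A chg P r n" and r: "r \<ge> 1"
    and G: "simple_graph G" "verts G = {1..n}"
    and chg: "\<And>j. j \<in> J \<Longrightarrow> chg G (D j) \<and> D j \<noteq> G \<and> v \<in> verts (D j) \<and> neighbors (D j) v = N"
    and inj: "inj_on (\<lambda>j. P (D j) v) J"
    and N: "finite N"
  shows "card J \<le> 2 ^ (B * card N * r)"
proof -
  \<comment> \<open>The only change comes in round 1, so the sequence is spaced for every
    \<open>r\<close> and the answer is due at round \<open>1 + r - 1 = r\<close>.\<close>
  define S where "S j i = (if i = 0 then G else D j)" for j and i :: nat
  let ?X = "{h. set h \<subseteq> observations N B \<and> length h = r}"
  have out: "output_at A (S j) r v = P (D j) v" if "j \<in> J" for j
  proof -
    have "dynamic_network chg n (S j)"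
      using G chg[OF that] by (auto simp: dynamic_network_def S_def)
    moreover have "spaced r (S j)"
      by (auto simp: spaced_def change_at_def S_def)
    moreover have "change_at (S j) 1"
      using chg[OF that] by (auto simp: change_at_def S_def)
    moreover have "v \<in> verts (S j 1)"
      using chg[OF that] by (auto simp: S_def)
    ultimately have "output_at A (S j) (1 + r - 1) v = P (S j 1) v"
      using A(2) unfolding solves_def by blast
    then show ?thesis by (simp add: S_def)
  qed
  have "inj_on (\<lambda>j. history A (S j) r v) J"
  proof (rule inj_onI)
    fix i j assume ij: "i \<in> J" "j \<in> J" and "history A (S i) r v = history A (S j) r v"
    \<comment> \<open>The answer also reads the initial graph, which is \<open>G\<close> for every
      \<open>j\<close>.\<close>
    then have "output_at A (S i) r v = output_at A (S j) r v"
      by (simp add: output_at_def S_def)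
    then have "P (D i) v = P (D j) v" using out ij by simp
    with inj ij show "i = j" by (auto dest: inj_onD)
  qed
  moreover have "(\<lambda>j. history A (S j) r v) ` J \<subseteq> ?X"
  proof (rule image_subsetI)
    fix j assume "j \<in> J"
    then have "neighbors (S j (Suc i)) v = N" for i
      using chg by (simp add: S_def)
    then show "history A (S j) r v \<in> ?X"
      using history_observations[OF A(1), of "S j" v N r] by simp
  qed
  moreover have "finite ?X"
    by (intro finite_lists_length_eq finite_observations N)
  ultimately have "card J \<le> card ?X" by (rule card_inj_on_le)
  also have "\<dots> = card (observations N B) ^ r"
    by (intro card_lists_length_eq finite_observations N)
  also have "\<dots> \<le> (2 ^ (B * card N)) ^ r"
    by (intro power_mono card_observations_le N) simp
  finally show ?thesis by (simp add: power_mult)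
qed

section \<open>Twins of a vertex\<close>

definition relabel :: "('a \<Rightarrow> 'b) \<Rightarrow> 'a ugraph \<Rightarrow> 'b ugraph" where
  "relabel f H = \<lparr>verts = f ` verts H, edges = (`) f ` edges H\<rparr>"

lemma simple_graph_relabel:
  assumes "simple_graph H" "inj_on f (verts H)"
  shows "simple_graph (relabel f H)"
proof -
  have "card (f ` e) = 2" if "e \<in> edges H" for e
    using assms that by (metis card_image inj_on_subset simple_graph_def)
  then show ?thesis
    using assms by (auto simp: simple_graph_def relabel_def)
qed

lemma graph_iso_relabel:
  assumes "simple_graph H" "inj_on f (verts H)"
  shows "graph_iso (relabel f H) H"
proof -
  let ?g = "inv_into (verts H) f"
  have "{f u, f v} \<in> (`) f ` edges H \<longleftrightarrow> {u, v} \<in> edges H"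
    if "u \<in> verts H" "v \<in> verts H" for u v
  proof
    assume "{f u, f v} \<in> (`) f ` edges H"
    then obtain e where e: "e \<in> edges H" "f ` {u, v} = f ` e" by auto
    moreover have "e \<subseteq> verts H" using assms(1) e(1) by (auto simp: simple_graph_def)
    ultimately have "{u, v} = e"
      using inj_on_image_eq_iff[OF assms(2), of "{u, v}" e] that by simp
    with e show "{u, v} \<in> edges H" by simp
  qed (use image_iff in fastforce)
  then show ?thesis
    unfolding graph_iso_def relabel_def
    using assms(2) by (intro exI[of _ ?g]) (auto intro!: bij_betw_inv_into inj_on_imp_bij_betw)
qed

text \<open>The labels below \<open>k\<close> go to the vertices other than \<open>z\<close>, so the
  labels from \<open>k\<close> to \<open>n\<close> are free for the twins of \<open>z\<close>. The
  bijection forces \<open>k = card (verts H)\<close>.\<close>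

locale twins =
  fixes H :: "'a ugraph" and x y z :: 'a and f :: "'a \<Rightarrow> nat" and k n :: nat
  assumes simple: "simple_graph H"
    and x: "x \<in> verts H" "x \<noteq> z" "{x, z} \<notin> edges H"
    and y: "{y, z} \<in> edges H"
    and f: "bij_betw f (verts H - {z}) {1..<k}"
begin

definition twin :: "nat \<Rightarrow> nat ugraph" where
  "twin j = relabel (f(z := j)) H"

definition host :: "nat ugraph" where
  "host = \<lparr>verts = {1..n}, edges = (\<Union>j\<in>{k..n}. edges (twin j))\<rparr>"

lemma f_range: "a \<in> verts H \<Longrightarrow> a \<noteq> z \<Longrightarrow> 1 \<le> f a \<and> f a < k"
  using f by (auto simp: bij_betw_def)

lemma y_props: "y \<in> verts H" "z \<in> verts H" "y \<noteq> z" "y \<noteq> x"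
  using y simple x(3) by (auto simp: simple_graph_def)

lemma f_x_neq_f_y: "f x \<noteq> f y"
  using f x y_props by (auto simp: bij_betw_def dest: inj_onD)

lemma k_pos: "k \<ge> 1"
  using f_range[OF x(1,2)] by simp

lemma inj_twin: "k \<le> j \<Longrightarrow> inj_on (f(z := j)) (verts H)"
proof -
  assume "k \<le> j"
  then have "a \<in> verts H \<Longrightarrow> a \<noteq> z \<Longrightarrow> f a \<noteq> j" for a using f_range[of a] by simp
  then show ?thesis using f unfolding bij_betw_def inj_on_def by (metis DiffI fun_upd_apply singletonD)
qed

lemma verts_twin: "verts (twin j) = insert j {1..<k}"
  using f y_props by (auto simp: twin_def relabel_def bij_betw_def)

lemma simple_twin: "k \<le> j \<Longrightarrow> simple_graph (twin j)"
  unfolding twin_def by (intro simple_graph_relabel simple inj_twin)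

lemma edge_twin: "{f y, j} \<in> edges (twin j)"
proof -
  have "(f(z := j)) ` {y, z} = {f y, j}" using y_props by auto
  with y show ?thesis unfolding twin_def relabel_def by (metis image_eqI ugraph.select_convs(2))
qed

lemma edges_twin_subset: "k \<le> j \<Longrightarrow> e \<in> edges (twin j) \<Longrightarrow> e \<subseteq> insert j {1..<k}"
  using simple_twin[of j] by (auto simp: simple_graph_def verts_twin)

lemma simple_host: "simple_graph host"
  unfolding simple_graph_def
proof (intro conjI ballI)
  show "finite (verts host)" by (simp add: host_def)
  fix e assume "e \<in> edges host"
  then obtain j where j: "k \<le> j" "j \<le> n" "e \<in> edges (twin j)" by (auto simp: host_def)
  show "card e = 2" using simple_twin[OF j(1)] j(3) by (auto simp: simple_graph_def)
  show "e \<subseteq> verts host"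
    using edges_twin_subset[OF j(1,3)] j(1,2) k_pos by (auto simp: host_def)
qed

text \<open>An edge from \<open>f x\<close> to a twin would come from an edge \<open>{z, x}\<close>
  of \<open>H\<close>. So the degree of \<open>f x\<close> stays below \<open>k\<close>, however
  large \<open>n\<close> is.\<close>

lemma neighbors_host: "neighbors host (f x) \<subseteq> {1..<k}"
proof
  fix u assume "u \<in> neighbors host (f x)"
  then obtain j where j: "k \<le> j" "{u, f x} \<in> edges (twin j)"
    by (auto simp: neighbors_def host_def)
  have "u \<noteq> j"
  proof
    assume "u = j"
    with j(2) obtain e where e: "e \<in> edges H" "{j, f x} = (f(z := j)) ` e"
      by (auto simp: twin_def relabel_def)
    have "(f(z := j)) ` {z, x} = (f(z := j)) ` e" using e(2) x(2) by auto
    moreover have "e \<subseteq> verts H" using simple e(1) by (auto simp: simple_graph_def)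
    ultimately have "{z, x} = e"
      using inj_on_image_eq_iff[OF inj_twin[OF j(1)], of "{z, x}" e] x y_props by simp
    with e(1) x(3) show False by (simp add: insert_commute)
  qed
  with edges_twin_subset[OF j] show "u \<in> {1..<k}" by auto
qed

lemma twin_in_MemList_iff:
  assumes "\<And>j. j \<in> {k..n} \<Longrightarrow> subgraph_of (twin j) G \<longleftrightarrow> j \<noteq> i"
    and "j \<in> {k..n}"
  shows "twin j \<in> MemList H G (f x) \<longleftrightarrow> j \<noteq> i"
proof -
  have "graph_iso (twin j) H"
    unfolding twin_def using assms(2) by (intro graph_iso_relabel simple inj_twin) simp
  moreover have "f x \<in> verts (twin j)"
    using f_range[OF x(1,2)] by (simp add: verts_twin)
  ultimately show ?thesis using assms by (auto simp: MemList_def)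
qed

text \<open>The part common to both types of change: all that matters is that \<open>D j\<close>
  destroys exactly the copy \<open>twin j\<close> and is not seen in the neighborhood of
  \<open>f x\<close>.\<close>

lemma twins_le:
  fixes A :: "nat ugraph set algorithm"
  assumes A: "uses_bandwidth A B" "solves A chg (MemList H) r n" and r: "r \<ge> 1"
    and D: "\<And>j. j \<in> {k..n} \<Longrightarrow> chg host (D j)"
      "\<And>j. j \<in> {k..n} \<Longrightarrow> f x \<in> verts (D j)"
      "\<And>j. j \<in> {k..n} \<Longrightarrow> neighbors (D j) (f x) = neighbors host (f x)"
    and sub: "\<And>i j. i \<in> {k..n} \<Longrightarrow> j \<in> {k..n} \<Longrightarrow> subgraph_of (twin j) (D i) \<longleftrightarrow> j \<noteq> i"
  shows "n + 1 - k \<le> 2 ^ (B * k * r)"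
proof -
  let ?N = "neighbors host (f x)"
  have "D j \<noteq> host" if "j \<in> {k..n}" for j
  proof
    assume "D j = host"
    with sub[OF that that] have "\<not> subgraph_of (twin j) host" by simp
    then show False
      using that simple_twin[of j] k_pos by (auto simp: subgraph_of_def host_def verts_twin)
  qed
  \<comment> \<open>For distinct \<open>i\<close> and \<open>j\<close>, \<open>twin i\<close> is
    listed in \<open>D j\<close> but not in \<open>D i\<close>.\<close>
  moreover have "inj_on (\<lambda>j. MemList H (D j) (f x)) {k..n}"
    by (rule inj_onI) (metis twin_in_MemList_iff sub)
  moreover have "finite ?N" using neighbors_host finite_subset by blast
  ultimately have "card {k..n} \<le> 2 ^ (B * card ?N * r)"
    using A r D simple_host
    by (intro card_changes_le[where chg = chg and P = "MemList H" and n = n and G = host and D = D and v = "f x"])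
      (simp_all add: host_def)
  also have "\<dots> \<le> 2 ^ (B * k * r)"
  proof -
    have "card ?N \<le> card {1..<k}" by (intro card_mono neighbors_host) simp
    then show ?thesis by (intro power_increasing mult_le_mono) auto
  qed
  finally show ?thesis by simp
qed

lemma edge_deletion_le:
  fixes A :: "nat ugraph set algorithm"
  assumes "uses_bandwidth A B" "solves A edge_deletion (MemList H) r n" "r \<ge> 1"
  shows "n + 1 - k \<le> 2 ^ (B * k * r)"
proof -
  define D where "D j = \<lparr>verts = verts host, edges = edges host - {{f y, j}}\<rparr>" for j
  show ?thesis
  proof (rule twins_le[OF assms, where D = D])
    fix j assume j: "j \<in> {k..n}"
    have "{f y, j} \<in> edges host" using edge_twin[of j] j by (auto simp: host_def)
    then show "edge_deletion host (D j)" unfolding edge_deletion_def D_def by blast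
    show "f x \<in> verts (D j)" using f_range[OF x(1,2)] j by (auto simp: D_def host_def)
    \<comment> \<open>The deleted edge avoids \<open>f x\<close>: \<open>f y\<close> differs from it
      because \<open>y\<close>, unlike \<open>x\<close>, is adjacent to \<open>z\<close>, and
      \<open>j\<close> is at least \<open>k\<close>.\<close>
    show "neighbors (D j) (f x) = neighbors host (f x)"
      using f_x_neq_f_y f_range[OF x(1,2)] j by (auto simp: D_def neighbors_def doubleton_eq_iff)
  next
    fix i j assume ij: "i \<in> {k..n}" "j \<in> {k..n}"
    \<comment> \<open>Copies share only labels below \<open>k\<close>, so the label \<open>i\<close>
      occurs in no copy but \<open>twin i\<close>.\<close>
    have "{f y, i} \<notin> edges (twin j)" if "j \<noteq> i"
      using edges_twin_subset[of j "{f y, i}"] ij that by auto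
    then show "subgraph_of (twin j) (D i) \<longleftrightarrow> j \<noteq> i"
      using edge_twin[of j] simple_twin[of j] ij k_pos
      by (auto simp: D_def subgraph_of_def host_def verts_twin)
  qed
qed

lemma node_deletion_le:
  fixes A :: "nat ugraph set algorithm"
  assumes "uses_bandwidth A B" "solves A node_deletion (MemList H) r n" "r \<ge> 1"
  shows "n + 1 - k \<le> 2 ^ (B * k * r)"
proof -
  define D where "D j = \<lparr>verts = verts host - {j}, edges = {e \<in> edges host. j \<notin> e}\<rparr>" for j
  show ?thesis
  proof (rule twins_le[OF assms, where D = D])
    fix j assume j: "j \<in> {k..n}"
    then have "j \<in> verts host" using k_pos by (simp add: host_def)
    then show "node_deletion host (D j)" unfolding node_deletion_def D_def by blast
    show "f x \<in> verts (D j)" using f_range[OF x(1,2)] j by (auto simp: D_def host_def)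
    show "neighbors (D j) (f x) = neighbors host (f x)"
      using neighbors_host f_range[OF x(1,2)] j by (auto simp: D_def neighbors_def)
  next
    fix i j assume ij: "i \<in> {k..n}" "j \<in> {k..n}"
    have "i \<notin> e" if "j \<noteq> i" "e \<in> edges (twin j)" for e
      using edges_twin_subset[of j e] ij that by auto
    then show "subgraph_of (twin j) (D i) \<longleftrightarrow> j \<noteq> i"
      using simple_twin[of j] ij k_pos by (auto simp: D_def subgraph_of_def host_def verts_twin)
  qed
qed

end

section \<open>The lower bound\<close>

lemma log_div_le_bandwidth:
  fixes k n r B :: nat
  assumes le: "n + 1 - k \<le> 2 ^ (B * k * r)" and k: "k \<ge> 1" and n: "n \<ge> 4 * k" and r: "r \<ge> 1"
  shows "1 / (2 * real k) * (log 2 (real n) / real r) \<le> real B"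
proof -
  let ?m = "n + 1 - k"
  \<comment> \<open>At least half of the labels are twins. Squaring turns this into
    \<open>n \<le> ?m ^ 2\<close>, which avoids an additive constant in the logarithm and costs the
    factor 2 in \<open>1 / (2 * real k)\<close>.\<close>
  have m: "n \<le> 2 * ?m" and "4 \<le> n" using k n by linarith+
  have "4 * n \<le> n * n" using \<open>4 \<le> n\<close> by (rule mult_le_mono1)
  also have "\<dots> \<le> (2 * ?m) * (2 * ?m)" using m m by (rule mult_le_mono)
  finally have "n \<le> ?m * ?m" by linarith
  then have "n \<le> ?m ^ 2" by (simp add: power2_eq_square)
  also have "\<dots> \<le> (2 ^ (B * k * r)) ^ 2" using le by (intro power_mono) auto
  finally have "n \<le> 2 ^ (B * k * r * 2)" by (simp add: power_mult)
  then have "real n \<le> 2 ^ (B * k * r * 2)" by (metis of_nat_le_iff of_nat_numeral of_nat_power)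
  then have "log 2 (real n) \<le> real (B * k * r * 2)"
    using \<open>4 \<le> n\<close> by (intro log_of_power_le) auto
  then show ?thesis using k r by (simp add: field_simps)
qed

text \<open>If no bandwidth suffices, the infimum is infinite and the bound is trivial. Otherwise
  the well-ordering of \<open>enat\<close> makes some algorithm attain it.\<close>

lemma bandwidth_complexity_geI:
  fixes P :: "'o problem"
  assumes "\<And>(A :: 'o algorithm) B. uses_bandwidth A B \<Longrightarrow> solves A chg P r n \<Longrightarrow> b \<le> real B"
  shows "ereal b \<le> ereal_of_enat (bandwidth_complexity chg P r n)"
proof -
  let ?S = "{enat B | B. \<exists>A :: 'o algorithm. uses_bandwidth A B \<and> solves A chg P r n}"
  show ?thesis
  proof (cases "?S = {}")
    case True
    then have "bandwidth_complexity chg P r n = \<infinity>"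
      unfolding bandwidth_complexity_def True by (simp add: top_enat_def)
    then show ?thesis by simp
  next
    case False
    then have "Inf ?S \<in> ?S" by (rule wellorder_InfI[OF some_in_eq[THEN iffD2]])
    then obtain A :: "'o algorithm" and B where
      "Inf ?S = enat B" "uses_bandwidth A B" "solves A chg P r n" by auto
    with assms show ?thesis unfolding bandwidth_complexity_def by simp
  qed
qed

lemma twins_exist:
  assumes H: "simple_graph H" "connected_graph H" "\<not> clique_graph H"
  obtains x y z f where "twins H x y z f (card (verts H))"
proof -
  obtain x z where xz: "x \<in> verts H" "z \<in> verts H" "x \<noteq> z" "{x, z} \<notin> edges H"
    using H(3) by (auto simp: clique_graph_def)
  then have "(z, x) \<in> {(x, y). {x, y} \<in> edges H}\<^sup>*"
    using H(2) by (auto simp: connected_graph_def)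
  \<comment> \<open>The first edge on a path from \<open>z\<close> to \<open>x\<close> ends in
    \<open>y\<close>.\<close>
  then obtain y where y: "{y, z} \<in> edges H"
    using xz(3) by (cases rule: converse_rtranclE) (auto simp: insert_commute)
  have fin: "finite (verts H)" using H(1) by (simp add: simple_graph_def)
  have "card (verts H - {z}) = card {1..<card (verts H)}" using fin xz by simp
  then obtain f :: "'a \<Rightarrow> nat" where "bij_betw f (verts H - {z}) {1..<card (verts H)}"
    using fin by (metis finite_Diff finite_atLeastLessThan finite_same_card_bij)
  with H xz y show ?thesis by (intro that) (unfold_locales; simp)
qed

theorem theorem5p12:
  fixes H :: "'a ugraph"
  assumes "simple_graph H" and "card (verts H) \<ge> 3"
    and "connected_graph H" and "\<not> clique_graph H"
  shows "(\<exists>c::real. c > 0 \<and> (\<exists>n0::nat. \<forall>n\<ge>n0. \<forall>r::nat. r \<ge> 1 \<longrightarrow>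
            ereal (c * (log 2 (real n) / real r))
              \<le> ereal_of_enat (bandwidth_complexity edge_deletion (MemList H) r n)))
       \<and> (\<exists>c::real. c > 0 \<and> (\<exists>n0::nat. \<forall>n\<ge>n0. \<forall>r::nat. r \<ge> 1 \<longrightarrow>
            ereal (c * (log 2 (real n) / real r))
              \<le> ereal_of_enat (bandwidth_complexity node_deletion (MemList H) r n)))"
proof -
  let ?k = "card (verts H)"
  obtain x y z f where "twins H x y z f ?k"
    using twins_exist[OF assms(1,3,4)] by blast
  \<comment> \<open>The vertices and the labeling are chosen before \<open>n\<close>, so the
    constant and the threshold \<open>4 * ?k\<close> depend on \<open>H\<close> alone.\<close>
  then interpret twins H x y z f ?k n for n .
  have k: "?k \<ge> 1" using assms(2) by simp
  then have c: "1 / (2 * real ?k) > 0" by simp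
  have "ereal (1 / (2 * real ?k) * (log 2 (real n) / real r))
      \<le> ereal_of_enat (bandwidth_complexity edge_deletion (MemList H) r n)"
    and "ereal (1 / (2 * real ?k) * (log 2 (real n) / real r))
      \<le> ereal_of_enat (bandwidth_complexity node_deletion (MemList H) r n)"
    if "n \<ge> 4 * ?k" "r \<ge> 1" for n r
    using bandwidth_complexity_geI log_div_le_bandwidth[OF edge_deletion_le k that]
      log_div_le_bandwidth[OF node_deletion_le k that] that(2) by blast+
  with c show ?thesis by blast
qed

end
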